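(* Let $G$ be a finite abelian group of order $n$ and suppose there is an $(n,m,k,\lambda)$-SEDF over $G$ with $k>1$ and $m>4$. Then the following hold: (1) $n\not\equiv 0\pmod k$; (2) for every prime divisor $p$ of $n$ with $\gcd(mk,p)=1$, one has $m\equiv 2\pmod p$.
   Context: Let $G$ be a finite abelian group of order $n$, written multiplicatively, with identity $e$. For nonempty subsets $A_1,A_2\subseteq G$, let $\Delta_E(A_1,A_2)$ be the multiset $\{xy^{-1} : x\in A_1,\ y\in A_2\}$. Let $k,\lambda,m$ be positive integers. An $(n,m,k,\lambda)$-strong external difference family (SEDF) over $G$ is a collection $\{A_1,\dots,A_m\}$ of pairwise disjoint $k$-element subsets of $G$ such that for each $1\le j\le m$ the multiset union $\bigcup_{\ell\neq j}\Delta_E(A_\ell,A_j)$ equals $\lambda(G\setminus\{e\})$, i.e. contains every non-identity element of $G$ exactly $\lambda$ times and does not contain $e$. *)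

theory Defs
  imports
    "HOL-Algebra.Coset"
    "HOL-Library.Multiset"
    "HOL-Library.Disjoint_Sets"
    "HOL-Number_Theory.Cong"
begin

definition ext_diff :: "('a, 'b) monoid_scheme \<Rightarrow> 'a set \<Rightarrow> 'a set \<Rightarrow> 'a multiset"
  where "ext_diff G X Y =
    image_mset (\<lambda>(x, y). x \<otimes>\<^bsub>G\<^esub> inv\<^bsub>G\<^esub> y) (mset_set (X \<times> Y))"

text \<open>The collection is given as a family indexed by \<open>{1..m}\<close>. Its members are nonempty
  because \<open>k > 0\<close>, so disjointness of the family makes them distinct sets.\<close>

definition SEDF ::
  "('a, 'b) monoid_scheme \<Rightarrow> nat \<Rightarrow> nat \<Rightarrow> nat \<Rightarrow> nat \<Rightarrow> (nat \<Rightarrow> 'a set) \<Rightarrow> bool"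
  where "SEDF G n m k l A \<longleftrightarrow>
    comm_group G \<and> finite (carrier G) \<and> order G = n \<and>
    m > 0 \<and> k > 0 \<and> l > 0 \<and>
    (\<forall>i\<in>{1..m}. A i \<subseteq> carrier G \<and> card (A i) = k) \<and>
    disjoint_family_on A {1..m} \<and>
    (\<forall>j\<in>{1..m}. (\<Sum>i\<in>{1..m} - {j}. ext_diff G (A i) (A j)) =
       repeat_mset l (mset_set (carrier G - {\<one>\<^bsub>G\<^esub>})))"

end

theory Submission
  imports
    Defs
    "HOL-Algebra.Sylow"
    "HOL-Algebra.Multiplicative_Group"
    "Jordan_Normal_Form.Char_Poly"
begin

text \<open>
  (1) Counting gives \<open>(m - 1) k\<^sup>2 = l (n - 1)\<close>. If \<open>k dvd n\<close>, then \<open>k\<^sup>2\<close> is coprime to \<open>n - 1\<close>, so it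
  divides \<open>l\<close> and \<open>n \<le> m\<close>, against \<open>m k \<le> n\<close>.

  (2) Take a character \<open>\<chi>\<close> of order \<open>p\<close> and put \<open>a\<^sub>i = \<chi>(A\<^sub>i)\<close>, \<open>D = \<Sum>\<^sub>i a\<^sub>i\<close>. The defining equations become
  \<open>(D - a\<^sub>j) cnj a\<^sub>j = - l\<close>. A sum of \<open>N\<close> values of \<open>\<chi>\<close> can vanish only if \<open>p dvd N\<close>: then
  \<open>\<zeta> - 1\<close> divides \<open>N\<close> in \<open>\<int>[\<zeta>]\<close>, so \<open>p\<close> divides \<open>N\<^sup>p\<close> there, hence also in \<open>\<int>\<close> by integrality. Hence \<open>D \<noteq> 0\<close>. So all \<open>a\<^sub>j / D\<close> are real roots of one quadratic
  \<open>t\<^sup>2 - t - c\<close> with \<open>c > 0\<close>, and they are not all equal since their sum is 1. Two distinct roots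
  add up to 1, so the remaining \<open>m - 2\<close> of the \<open>a\<^sub>i\<close> sum to 0 and \<open>p dvd (m - 2) k\<close>.
\<close>

(* Polynomial.order would shadow the order of a group. *)
hide_const (open) Polynomial.order

section \<open>Integrality and vanishing sums of \<open>p\<close>-th roots of unity\<close>

text \<open>The characteristic polynomial of an integer matrix is monic with integer coefficients,
  and \<open>y\<close> is one of its roots.\<close>

lemma algebraic_int_if_int_matrix_eigenvalue:
  fixes y :: complex and c :: "nat \<Rightarrow> nat \<Rightarrow> int"
  assumes eig: "\<And>i. i < n \<Longrightarrow> (\<Sum>j<n. of_int (c i j) * v j) = y * v i"
    and nz: "\<exists>i<n. v i \<noteq> 0"
  shows "algebraic_int y"
proof -
  define A where "A = mat n n (\<lambda>(i, j). c i j)"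
  have A: "A \<in> carrier_mat n n" by (simp add: A_def)
  have "eigenvector (map_mat of_int A) (vec n v) y"
  proof -
    have "map_mat of_int A *\<^sub>v vec n v = y \<cdot>\<^sub>v vec n v"
      by (rule eq_vecI) (auto simp: A_def scalar_prod_def eig lessThan_atLeast0[symmetric])
    moreover have "vec n v \<noteq> 0\<^sub>v n"
      using nz by (metis index_vec index_zero_vec(1))
    ultimately show ?thesis
      using A by (simp add: eigenvector_def)
  qed
  hence "eigenvalue (map_mat of_int A) y"
    by (auto simp: eigenvalue_def)
  hence "poly (char_poly (map_mat of_int A)) y = 0"
    using eigenvalue_root_char_poly[of "map_mat of_int A" n y] A by simp
  hence "poly (map_poly of_int (char_poly A)) y = 0"
    by (simp add: of_int_hom.char_poly_hom[OF A])
  thus ?thesis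
    using degree_monic_char_poly[OF A] by (auto simp: algebraic_int_altdef_ipoly)
qed

text \<open>Exponents matter only modulo \<open>p\<close>, so coefficients can be collected by
  residue. This makes \<open>\<int>[\<zeta>]\<close> finitely generated, as the eigenvalue criterion
  requires.\<close>

lemma int_poly_at_root_of_unity:
  fixes \<zeta> :: complex and q :: "int poly"
  assumes "\<zeta> ^ p = 1" "p > 0"
  shows "\<exists>c. poly (of_int_poly q) \<zeta> = (\<Sum>j<p. of_int (c j) * \<zeta> ^ j)"
proof -
  define c where "c j = (\<Sum>i\<in>{i\<in>{..degree q}. i mod p = j}. coeff q i)" for j
  have pw: "\<zeta> ^ i = \<zeta> ^ (i mod p)" for i
    using assms(1) by (metis div_mult_mod_eq mult.commute mult_1 power_add power_mult power_one)
  have "poly (of_int_poly q) \<zeta> = (\<Sum>i\<le>degree q. of_int (coeff q i) * \<zeta> ^ i)"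
    by (simp add: poly_altdef)
  also have "\<dots> = (\<Sum>j<p. \<Sum>i\<in>{i\<in>{..degree q}. i mod p = j}. of_int (coeff q i) * \<zeta> ^ i)"
    using assms(2) by (intro sum.group[symmetric]) auto
  also have "\<dots> = (\<Sum>j<p. of_int (c j) * \<zeta> ^ j)"
    unfolding c_def of_int_sum sum_distrib_right
    by (intro sum.cong refl, subst pw) simp
  finally show ?thesis by blast
qed

text \<open>Multiplication by the given element sends each of the first \<open>p\<close> powers of
  \<zeta> to an integer combination of them, so the vector of these powers is an eigenvector of an
  integer matrix.\<close>

lemma algebraic_int_int_poly_at_root_of_unity:
  fixes \<zeta> :: complex and q :: "int poly"
  assumes "\<zeta> ^ p = 1" "p > 0"
  shows "algebraic_int (poly (of_int_poly q) \<zeta>)"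
proof -
  have "\<exists>c. poly (of_int_poly q) \<zeta> * \<zeta> ^ i = (\<Sum>j<p. of_int (c j) * \<zeta> ^ j)" for i
    using int_poly_at_root_of_unity[OF assms, of "q * monom 1 i"]
    by (simp add: of_int_poly_hom.hom_mult poly_monom)
  then obtain c where "\<And>i. poly (of_int_poly q) \<zeta> * \<zeta> ^ i = (\<Sum>j<p. of_int (c i j) * \<zeta> ^ j)"
    by metis
  moreover have "\<exists>i<p. \<zeta> ^ i \<noteq> 0"
    using assms(2) by (intro exI[of _ 0]) auto
  ultimately show ?thesis
    by (intro algebraic_int_if_int_matrix_eigenvalue[where n = p and v = "\<lambda>i. \<zeta> ^ i" and c = c]) auto
qed

lemma prime_dvd_poly_1_if_root_of_unity_root:
  fixes \<zeta> :: complex and q :: "int poly"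
  assumes p: "prime p" and \<zeta>: "\<zeta> ^ p = 1" and root: "poly (of_int_poly q) \<zeta> = 0"
  shows "int p dvd poly q 1"
proof -
  \<comment> \<open>Elements of \<open>\<int>[\<zeta>]\<close> are represented by integer
    polynomials, so a divisibility there is shown by naming a polynomial cofactor.\<close>
  define ev :: "int poly \<Rightarrow> complex" where "ev q = poly (of_int_poly q) \<zeta>" for q
  have ev_mult: "ev (q * r) = ev q * ev r" and ev_diff: "ev (q - r) = ev q - ev r"
    and ev_uminus: "ev (- q) = - ev q" and ev_power: "ev (q ^ i) = ev q ^ i"
    and ev_smult: "ev (Polynomial.smult a q) = of_int a * ev q" and ev_sum: "ev (sum f S) = (\<Sum>x\<in>S. ev (f x))"
    for q r i a and f :: "nat \<Rightarrow> int poly" and S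
    by (simp_all add: ev_def of_int_poly_hom.hom_mult of_int_poly_hom.hom_minus
        of_int_poly_hom.hom_uminus of_int_poly_hom.hom_power of_int_poly_hom.hom_sum poly_sum
        of_int_hom.map_poly_hom_smult)
  have ev_linear: "ev [:a, b:] = of_int a + \<zeta> * of_int b" and ev_const: "ev [:a:] = of_int a" for a b
    by (simp_all add: ev_def of_int_hom.map_poly_pCons_hom)
  have p0: "p > 0" using p prime_gt_0_nat by blast
  have "poly ([:poly q 1:] - q) 1 = 0" by simp
  then obtain r where "[:poly q 1:] - q = [:-1, 1:] * r"
    by (metis dvdE poly_eq_0_iff_dvd)
  hence "ev ([:poly q 1:] - q) = ev ([:-1, 1:] * r)" by (rule arg_cong)
  hence "of_int (poly q 1) - ev q = (\<zeta> - 1) * ev r"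
    unfolding ev_diff ev_mult ev_linear ev_const by simp
  moreover have "ev q = 0" using root by (simp only: ev_def)
  ultimately have N: "of_int (poly q 1) = (\<zeta> - 1) * ev r" by simp
  (* Expanding 1 = ((\<zeta> - 1) + 1)^p shows that p divides (\<zeta> - 1)^p in \<int>[\<zeta>]. *)
  define b where "b k = int ((p choose k) div p)" for k
  have b: "of_nat (p choose k) = (of_nat p * of_int (b k) :: complex)" if "k \<in> {1..<p}" for k
  proof -
    have "p dvd p choose k"
      using that p by (intro dvd_choose_prime) auto
    hence "p choose k = p * ((p choose k) div p)" by simp
    thus ?thesis unfolding b_def by (metis of_int_of_nat_eq of_nat_mult)
  qed
  define s where "s = (\<Sum>k\<in>{1..<p}. Polynomial.smult (b k) ([:-1, 1:] ^ k))"
  have ev_s: "ev s = (\<Sum>k\<in>{1..<p}. of_int (b k) * (\<zeta> - 1) ^ k)"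
    by (simp add: s_def ev_sum ev_smult ev_power ev_linear)
  have "((\<zeta> - 1) + 1) ^ p = (\<Sum>k\<le>p. of_nat (p choose k) * (\<zeta> - 1) ^ k)"
    by (subst binomial_ring) simp
  also have "{..p} = insert 0 (insert p {1..<p})" using p0 by auto
  also have "(\<Sum>k\<in>\<dots>. of_nat (p choose k) * (\<zeta> - 1) ^ k) =
      1 + (\<zeta> - 1) ^ p + (\<Sum>k\<in>{1..<p}. of_nat (p choose k) * (\<zeta> - 1) ^ k)"
    using p0 by simp
  also have "(\<Sum>k\<in>{1..<p}. of_nat (p choose k) * (\<zeta> - 1) ^ k) = of_nat p * ev s"
    unfolding ev_s sum_distrib_left by (intro sum.cong) (simp_all add: b)
  finally have "1 + ((\<zeta> - 1) ^ p + of_nat p * ev s) = 1"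
    using \<zeta> by (simp add: add.assoc)
  hence \<zeta>1: "(\<zeta> - 1) ^ p = - (of_nat p * ev s)"
    by (simp only: eq_neg_iff_add_eq_0 add_cancel_left_right)
  \<comment> \<open>\<open>w\<close> represents the quotient of \<open>poly q 1 ^ p\<close> by
    \<open>p\<close>: raise \<open>N\<close> to the power \<open>p\<close> and substitute
    \<open>\<zeta>1\<close>.\<close>
  define w where "w = - (s * r ^ p)"
  have "of_int (poly q 1 ^ p) = ((\<zeta> - 1) * ev r) ^ p"
    by (simp only: of_int_power N)
  also have "\<dots> = of_nat p * ev w"
    by (simp only: power_mult_distrib \<zeta>1 w_def ev_mult ev_power ev_uminus
        mult_minus_left mult_minus_right mult.assoc)
  finally have Np: "of_int (poly q 1 ^ p) = of_nat p * ev w" .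
  \<comment> \<open>As an element of \<open>\<int>[\<zeta>]\<close> this quotient is an algebraic
    integer, and as a ratio of integers it is rational.\<close>
  have "ev w \<in> \<int>"
  proof (rule rational_algebraic_int_is_int)
    show "algebraic_int (ev w)"
      unfolding ev_def using \<zeta> p0 by (rule algebraic_int_int_poly_at_root_of_unity)
    have "ev w = of_int (poly q 1 ^ p) / of_int (int p)"
      unfolding Np using p0 by simp
    also have "\<dots> \<in> \<rat>" by (rule Rats_divide[OF Rats_of_int Rats_of_int])
    finally show "ev w \<in> \<rat>" .
  qed
  then obtain t where "ev w = of_int t" by (rule Ints_cases)
  hence "of_int (poly q 1 ^ p) = (of_int (int p * t) :: complex)"
    unfolding Np by simp
  hence "poly q 1 ^ p = int p * t" unfolding of_int_eq_iff .
  hence "int p dvd poly q 1 ^ p" by (rule dvdI)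
  moreover have "prime (int p)" using p by simp
  ultimately show ?thesis by (rule prime_dvd_power[rotated])
qed

text \<open>All values of \<open>f\<close> are powers of one primitive root, so the sum is an
  integer polynomial evaluated there, and its value at 1 is the sum of the weights.\<close>

lemma prime_dvd_sum_if_sum_of_roots_of_unity_eq_0:
  fixes f :: "'a \<Rightarrow> complex" and c :: "'a \<Rightarrow> int"
  assumes p: "prime p" and f: "\<And>x. x \<in> S \<Longrightarrow> f x ^ p = 1"
    and sum0: "(\<Sum>x\<in>S. of_int (c x) * f x) = 0"
  shows "int p dvd (\<Sum>x\<in>S. c x)"
proof -
  define \<zeta> where "\<zeta> = cis (2 * pi / p)"
  have p0: "p > 0" using p prime_gt_0_nat by blast
  have "\<exists>e. f x = \<zeta> ^ e" if x: "x \<in> S" for x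
  proof -
    have "f x \<in> (\<lambda>k. cis (2 * pi * real k / real p)) ` {..<p}"
      using bij_betw_roots_unity[OF p0] f[OF x] by (auto simp: bij_betw_def)
    then obtain k where "f x = cis (2 * pi * real k / real p)" by blast
    also have "\<dots> = \<zeta> ^ k" by (simp add: \<zeta>_def DeMoivre mult_ac)
    finally show ?thesis by blast
  qed
  then obtain e where e: "\<And>x. x \<in> S \<Longrightarrow> f x = \<zeta> ^ e x" by metis
  define q where "q = (\<Sum>x\<in>S. monom (c x) (e x))"
  have "poly (of_int_poly q) \<zeta> = (\<Sum>x\<in>S. of_int (c x) * f x)"
    by (simp add: q_def of_int_poly_hom.hom_sum poly_sum poly_monom e)
  moreover have "\<zeta> ^ p = 1" using p0 by (simp add: \<zeta>_def DeMoivre)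
  moreover have "poly q 1 = (\<Sum>x\<in>S. c x)"
    by (simp add: q_def poly_sum poly_monom)
  ultimately show ?thesis
    using prime_dvd_poly_1_if_root_of_unity_root[OF p, of \<zeta> q] sum0 by simp
qed

section \<open>Characters of prime order\<close>

text \<open>The character is trivial on a maximal proper subgroup \<open>H\<close> above the
  \<open>p\<close>-th powers and reads off the exponent of a fixed \<open>x\<close> outside
  \<open>H\<close>.\<close>

lemma (in comm_group) prime_character_exists:
  assumes fin: "finite (carrier G)" and p: "prime p" and dvd: "p dvd order G"
  shows "\<exists>\<chi> :: 'a \<Rightarrow> complex.
    (\<forall>g\<in>carrier G. \<forall>h\<in>carrier G. \<chi> (g \<otimes> h) = \<chi> g * \<chi> h) \<and>
    (\<forall>g\<in>carrier G. \<chi> g ^ p = 1) \<and> (\<exists>g\<in>carrier G. \<chi> g \<noteq> 1)"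
proof -
  let ?P = "(\<lambda>x. x [^] p) ` carrier G"
  have P: "subgroup ?P G"
  proof (rule subgroupI)
    fix a assume "a \<in> ?P"
    thus "inv a \<in> ?P" by (auto simp: nat_pow_inv[symmetric] intro!: imageI)
  next
    fix a b assume "a \<in> ?P" "b \<in> ?P"
    thus "a \<otimes> b \<in> ?P" by (auto simp: nat_pow_distrib[symmetric] intro!: imageI)
  qed auto
  \<comment> \<open>On a finite group a surjective power map is injective, but Cauchy's theorem
    (Sylow with exponent 1) yields a nontrivial element killed by it.\<close>
  have P_proper: "?P \<noteq> carrier G"
  proof
    assume "?P = carrier G"
    hence inj: "inj_on (\<lambda>x. x [^] p) (carrier G)"
      using fin by (simp add: eq_card_imp_inj_on)
    obtain M where "order G = p * M" using dvd by blast
    then obtain K where K: "subgroup K G" "card K = p"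
      using sylow_thm[OF p is_group, of 1 M] fin by auto
    have "1 < card K" using K p prime_gt_1_nat by simp
    hence "\<not> K \<subseteq> {\<one>}"
      using card_mono[of "{\<one>}" K] by auto
    then obtain x where x: "x \<in> K" "x \<noteq> \<one>" by blast
    have xG: "x \<in> carrier G" using x(1) by (rule subgroup.mem_carrier[OF K(1)])
    interpret K: group "G\<lparr>carrier := K\<rparr>" using K(1) by (rule subgroup_imp_group)
    have "x [^] p = \<one>"
      using K.pow_order_eq_1[of x] K x by (simp add: Coset.order_def flip: nat_pow_consistent)
    hence "x = \<one>" using inj_onD[OF inj, of x \<one>] xG by simp
    with x show False by simp
  qed
  (* A maximal proper subgroup containing all p-th powers has index p. *)
  define \<S> where "\<S> = {H. subgroup H G \<and> ?P \<subseteq> H \<and> H \<noteq> carrier G}"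
  have "finite \<S>"
    by (rule finite_subset[of _ "Pow (carrier G)"]) (auto simp: \<S>_def fin dest: subgroup.subset)
  moreover have "\<S> \<noteq> {}" using P P_proper by (auto simp: \<S>_def)
  ultimately obtain H where "H \<in> \<S>" and max: "\<And>K. K \<in> \<S> \<Longrightarrow> H \<subseteq> K \<Longrightarrow> H = K"
    using finite_has_maximal by metis
  hence H: "subgroup H G" "?P \<subseteq> H" "H \<noteq> carrier G" by (auto simp: \<S>_def)
  interpret H: subgroup H G by (rule H(1))
  obtain x where x: "x \<in> carrier G" "x \<notin> H" using H H.subset by blast
  have mult_p: "y [^] (int p * i) \<in> H" if "y \<in> carrier G" for y and i :: int
  proof -
    have "y [^] (int p * i) = (y [^] i) [^] p"
      using that by (simp add: int_pow_pow mult.commute flip: int_pow_int)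
    thus ?thesis using H(2) that by blast
  qed
  \<comment> \<open>If \<open>i\<close> were coprime to \<open>p\<close>, Bezout would write
    \<open>x\<close> as a power of \<open>x [^] i\<close> times a \<open>p\<close>-th power, putting
    \<open>x\<close> in \<open>H\<close>.\<close>
  have pow_mem: "int p dvd i" if "x [^] i \<in> H" for i :: int
  proof (rule ccontr)
    assume "\<not> int p dvd i"
    hence "coprime i (int p)"
      using p prime_imp_coprime[of "int p" i] by (simp add: coprime_commute)
    moreover obtain u v where "u * i + v * int p = gcd i (int p)"
      using bezout_int by blast
    ultimately have uv: "i * u + int p * v = 1" by (simp add: mult.commute)
    have "x = x [^] (i * u + int p * v)" using x by (simp add: uv)
    also have "\<dots> = (x [^] i) [^] u \<otimes> x [^] (int p * v)"
      using x by (simp add: int_pow_mult int_pow_pow)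
    also have "\<dots> \<in> H"
      using that mult_p[OF x(1)] H(1) by (simp add: subgroup_int_pow_closed)
    finally show False using x by simp
  qed
  \<comment> \<open>\<open>K\<close> is the subgroup generated by \<open>H\<close> and
    \<open>x\<close>; maximality of \<open>H\<close> forces it to be the whole group.\<close>
  define K where "K = {g \<in> carrier G. \<exists>i::int. g \<otimes> x [^] i \<in> H}"
  have mult_mem: "(g \<otimes> h) \<otimes> x [^] (i + j) \<in> H"
    if "g \<in> carrier G" "h \<in> carrier G" "g \<otimes> x [^] i \<in> H" "h \<otimes> x [^] j \<in> H" for g h and i j :: int
  proof -
    have "(g \<otimes> h) \<otimes> x [^] (i + j) = (g \<otimes> x [^] i) \<otimes> (h \<otimes> x [^] j)"
      using that x by (simp add: int_pow_mult m_ac)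
    thus ?thesis using that by simp
  qed
  have inv_mem: "inv g \<otimes> x [^] (- i) \<in> H" if "g \<in> carrier G" "g \<otimes> x [^] i \<in> H" for g and i :: int
  proof -
    have "inv g \<otimes> x [^] (- i) = inv (g \<otimes> x [^] i)"
      using that x by (simp add: int_pow_neg inv_mult)
    thus ?thesis using that by simp
  qed
  have x_mem: "x \<otimes> x [^] (-1::int) \<in> H"
    using x by (simp add: int_pow_neg)
  have "subgroup K G"
  proof (rule subgroupI)
    have "\<one> \<otimes> x [^] (0::int) \<in> H" by simp
    thus "K \<noteq> {}" unfolding K_def by blast
  qed (auto simp: K_def intro: mult_mem inv_mem)
  moreover have "H \<subseteq> K"
  proof
    fix h assume "h \<in> H"
    moreover from this have "h \<otimes> x [^] (0::int) \<in> H" by simp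
    ultimately show "h \<in> K" unfolding K_def using H.subset by blast
  qed
  moreover have "x \<in> K" using x x_mem unfolding K_def by blast
  ultimately have "K = carrier G" using max[of K] H(2) x(2) unfolding \<S>_def by blast
  hence "\<exists>i::int. g \<otimes> x [^] i \<in> H" if "g \<in> carrier G" for g
    using that unfolding K_def by blast
  then obtain e where e: "\<And>g. g \<in> carrier G \<Longrightarrow> g \<otimes> x [^] (e g :: int) \<in> H"
    by metis
  have "\<exists>\<zeta>::complex. \<zeta> ^ p = 1 \<and> \<zeta> \<noteq> 1"
  proof (rule ccontr)
    assume "\<not> ?thesis"
    hence "{\<zeta>::complex. \<zeta> ^ p = 1} = {1}" by auto
    moreover have "card {\<zeta>::complex. \<zeta> ^ p = 1} = p"
      using p prime_gt_0_nat by (intro card_roots_unity_eq) auto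
    ultimately show False using p by auto
  qed
  then obtain \<zeta> :: complex where \<zeta>: "\<zeta> ^ p = 1" "\<zeta> \<noteq> 1" by blast
  have \<zeta>0: "\<zeta> \<noteq> 0"
    using \<zeta>(1) prime_gt_0_nat[OF p] by (auto simp: power_0_left)
  \<comment> \<open>The chosen exponent \<open>e g\<close> is determined only modulo
    \<open>p\<close>: two admissible exponents differ by some \<open>d\<close> with
    \<open>x [^] d\<close> in \<open>H\<close>. Hence the power of \<zeta> is well defined, which
    gives multiplicativity below.\<close>
  have \<zeta>_eq: "\<zeta> powi e g = \<zeta> powi i" if "g \<in> carrier G" "g \<otimes> x [^] i \<in> H" for g i
  proof -
    have "(g \<otimes> inv g) \<otimes> x [^] (e g + - i) \<in> H"
      using that e by (intro mult_mem inv_mem) auto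
    hence "int p dvd e g - i" using that x by (intro pow_mem) simp
    then obtain t where "e g = int p * t + i" by (metis dvdE diff_add_cancel)
    thus ?thesis using \<zeta>0 \<zeta>(1) by (simp add: power_int_add power_int_mult)
  qed
  show ?thesis
  proof (intro exI[of _ "\<lambda>g. \<zeta> powi e g"] conjI ballI)
    fix g h assume gh: "g \<in> carrier G" "h \<in> carrier G"
    have "\<zeta> powi e (g \<otimes> h) = \<zeta> powi (e g + e h)"
      using gh e by (intro \<zeta>_eq mult_mem) auto
    thus "\<zeta> powi e (g \<otimes> h) = \<zeta> powi e g * \<zeta> powi e h"
      using \<zeta>0 by (simp add: power_int_add)
  next
    fix g assume "g \<in> carrier G"
    have "(\<zeta> powi e g) ^ p = (\<zeta> ^ p) powi e g"
      by (metis mult.commute power_int_mult power_int_of_nat)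
    thus "(\<zeta> powi e g) ^ p = 1" using \<zeta> by simp
  next
    have "\<zeta> powi e x = inverse \<zeta>" using \<zeta>_eq[OF x(1) x_mem] by simp
    thus "\<exists>g\<in>carrier G. \<zeta> powi e g \<noteq> 1"
      using x(1) \<zeta>(2) by (intro bexI[of _ x]) simp_all
  qed
qed

section \<open>Summation over an SEDF, counting, and part (1)\<close>

text \<open>Turns the multiset equation into one for sums: \<open>f\<close> constantly 1 gives the
  counting identity, \<open>f\<close> a character gives the quadratic equations.\<close>

lemma SEDF_sum:
  fixes f :: "'a \<Rightarrow> 'c::comm_semiring_1"
  assumes S: "SEDF G n m k l A" and j: "j \<in> {1..m}"
  shows "(\<Sum>i\<in>{1..m} - {j}. \<Sum>x\<in>A i. \<Sum>y\<in>A j. f (x \<otimes>\<^bsub>G\<^esub> inv\<^bsub>G\<^esub> y)) =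
    of_nat l * (\<Sum>g\<in>carrier G - {\<one>\<^bsub>G\<^esub>}. f g)"
proof -
  have sum_mset_sum: "\<Sum>\<^sub># (image_mset f (\<Sum>i\<in>I. M i)) = (\<Sum>i\<in>I. \<Sum>\<^sub># (image_mset f (M i)))"
    for I :: "nat set" and M
    by (induction I rule: infinite_finite_induct) auto
  have sum_mset_repeat: "\<Sum>\<^sub># (image_mset f (repeat_mset a M)) = of_nat a * \<Sum>\<^sub># (image_mset f M)"
    for a M
    by (induction a) (simp_all only: repeat_mset_0 repeat_mset_Suc image_mset_empty image_mset_union
        sum_mset.empty sum_mset.union of_nat_0 of_nat_Suc mult_zero_left distrib_right mult_1_left)
  have "(\<Sum>i\<in>{1..m} - {j}. ext_diff G (A i) (A j)) =
      repeat_mset l (mset_set (carrier G - {\<one>\<^bsub>G\<^esub>}))"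
    using S j unfolding SEDF_def by blast
  from arg_cong[OF this, of "\<lambda>M. \<Sum>\<^sub># (image_mset f M)"]
  have "(\<Sum>i\<in>{1..m} - {j}. \<Sum>\<^sub># (image_mset f (ext_diff G (A i) (A j)))) =
      of_nat l * (\<Sum>g\<in>carrier G - {\<one>\<^bsub>G\<^esub>}. f g)"
    by (simp add: sum_mset_sum sum_mset_repeat flip: sum_unfold_sum_mset)
  moreover have "\<Sum>\<^sub># (image_mset f (ext_diff G X Y)) = (\<Sum>x\<in>X. \<Sum>y\<in>Y. f (x \<otimes>\<^bsub>G\<^esub> inv\<^bsub>G\<^esub> y))"
    for X Y
  proof -
    have "\<Sum>\<^sub># (image_mset f (ext_diff G X Y)) = (\<Sum>(x, y)\<in>X \<times> Y. f (x \<otimes>\<^bsub>G\<^esub> inv\<^bsub>G\<^esub> y))"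
      by (simp add: ext_diff_def multiset.map_comp sum_unfold_sum_mset o_def case_prod_unfold)
    thus ?thesis by (simp add: sum.cartesian_product)
  qed
  ultimately show ?thesis by simp
qed

lemma SEDF_count:
  assumes S: "SEDF G n m k l A"
  shows "(m - 1) * k ^ 2 = l * (n - 1)"
proof -
  interpret comm_group G using S by (simp add: SEDF_def)
  have m: "1 \<in> {1..m}" using S by (auto simp: SEDF_def)
  have A: "card (A i) = k" if "i \<in> {1..m}" for i using S that by (auto simp: SEDF_def)
  have "(\<Sum>i\<in>{1..m} - {1}. \<Sum>x\<in>A i. \<Sum>y\<in>A 1. 1) = (\<Sum>i\<in>{1..m} - {1}. k * k)"
    by (intro sum.cong) (use m A in auto)
  hence "(m - 1) * (k * k) = l * card (carrier G - {\<one>\<^bsub>G\<^esub>})"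
    using SEDF_sum[OF S m, of "\<lambda>_. 1 :: nat"] m by simp
  also have "card (carrier G - {\<one>\<^bsub>G\<^esub>}) = n - 1"
    using S by (simp add: SEDF_def Coset.order_def)
  finally show ?thesis by (simp add: power2_eq_square)
qed

lemma SEDF_card_le:
  assumes S: "SEDF G n m k l A"
  shows "m * k \<le> n"
proof -
  have fin: "finite (carrier G)" and A: "\<And>i. i \<in> {1..m} \<Longrightarrow> A i \<subseteq> carrier G \<and> card (A i) = k"
    and dis: "disjoint_family_on A {1..m}" and n: "card (carrier G) = n"
    using S by (auto simp: SEDF_def Coset.order_def)
  have "card (\<Union>i\<in>{1..m}. A i) = (\<Sum>i\<in>{1..m}. card (A i))"
    using A fin dis by (intro card_UN_disjoint') (auto intro: finite_subset)
  also have "\<dots> = m * k" using A by simp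
  finally have "m * k = card (\<Union>i\<in>{1..m}. A i)" ..
  also have "\<dots> \<le> n" unfolding n[symmetric] 
    by (intro card_mono fin UN_least) (use A in blast)
  finally show ?thesis .
qed

lemma SEDF_not_dvd:
  assumes S: "SEDF G n m k l A" and k: "k > 1" and m: "m > 1"
  shows "\<not> k dvd n"
proof
  assume kn: "k dvd n"
  have l: "l > 0" using S by (simp add: SEDF_def)
  have count: "(m - 1) * k ^ 2 = l * (n - 1)" and mk: "m * k \<le> n"
    using S by (rule SEDF_count, rule SEDF_card_le)
  have n: "n > 0" using mk k m by (cases n) auto
  have "coprime n (n - 1)" using n using coprime_diff_one_left_nat coprime_commute by blast
  hence "coprime (k ^ 2) (n - 1)" using kn by (meson coprime_divisors coprime_power_left_iff dvd_refl)
  moreover have "k ^ 2 dvd l * (n - 1)" using count by (metis dvd_triv_right)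
  ultimately have "k ^ 2 dvd l" by (simp add: coprime_dvd_mult_left_iff)
  hence "k ^ 2 \<le> l" using l by (rule dvd_imp_le)
  \<comment> \<open>Replacing \<open>l\<close> by the smaller \<open>k ^ 2\<close> and cancelling
    leaves \<open>n \<le> m\<close>, whereas \<open>k \<ge> 2\<close> gives
    \<open>2 * m \<le> m * k \<le> n\<close>.\<close>
  hence "k ^ 2 * (n - 1) \<le> (m - 1) * k ^ 2" using count by simp
  hence "n - 1 \<le> m - 1" using k by simp
  moreover have "m * 2 \<le> m * k" using k by simp
  ultimately show False using mk m by linarith
qed

section \<open>The quadratic equation and part (2)\<close>

lemma pair_sum_eq_total_if_quadratic:
  fixes a :: "'i \<Rightarrow> complex" and l :: real
  assumes D: "(\<Sum>i\<in>I. a i) = D" "D \<noteq> 0" and l: "l > 0"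
    and eq: "\<And>i. i \<in> I \<Longrightarrow> (D - a i) * cnj (a i) = - of_real l"
  shows "\<exists>i\<in>I. \<exists>j\<in>I. i \<noteq> j \<and> a i + a j = D"
proof -
  \<comment> \<open>The constant that appears when \<open>eq\<close> is divided by
    \<open>D * cnj D\<close>.\<close>
  define c where "c = l / (cmod D)\<^sup>2"
  have c: "c > 0" using l D by (simp add: c_def)
  have "\<exists>t. a i = D * of_real t \<and> t * t - t = c" if i: "i \<in> I" for i
  proof -
    define b where "b = a i / D"
    have ab: "a i = D * b" using D by (simp add: b_def)
    have "D * cnj D * ((1 - b) * cnj b) = - of_real l"
      using eq[OF i] by (simp add: ab algebra_simps)
    hence "of_real ((cmod D)\<^sup>2) * ((1 - b) * cnj b) = - of_real l"
      by (simp only: complex_norm_square)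
    hence "(1 - b) * cnj b = - of_real c"
      using D by (simp add: c_def field_simps)
    hence "cnj b = b * cnj b - of_real c" by (simp add: algebra_simps)
    \<comment> \<open>The right-hand side is real, so \<open>b\<close> is real and conjugation
      disappears from the equation.\<close>
    hence cb: "cnj b = of_real ((cmod b)\<^sup>2 - c)"
      by (simp only: complex_norm_square of_real_diff)
    define t where "t = (cmod b)\<^sup>2 - c"
    have bt: "b = of_real t" using cb by (metis complex_cnj_cnj complex_cnj_complex_of_real t_def)
    hence "(cmod b)\<^sup>2 = t\<^sup>2" by simp
    hence "t = t\<^sup>2 - c" using t_def by linarith
    thus ?thesis using ab bt by (intro exI[of _ t]) (simp add: power2_eq_square)
  qed
  then obtain t where t: "\<And>i. i \<in> I \<Longrightarrow> a i = D * of_real (t i)"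
    and q: "\<And>i. i \<in> I \<Longrightarrow> t i * t i - t i = c" by metis
  have "D * of_real (\<Sum>i\<in>I. t i) = D * 1"
    using D(1) by (simp add: t sum_distrib_left)
  hence sum_t: "(\<Sum>i\<in>I. t i) = 1"
    using D(2) by (metis mult_left_cancel of_real_eq_1_iff)
  \<comment> \<open>A common value would be \<open>1 / card I\<close>, which lies in (0,1], where
    \<open>t * t - t\<close> is at most 0 and cannot equal \<open>c\<close>. An infinite
    \<open>I\<close> is excluded because its sum would be 0 by convention.\<close>
  have "\<exists>i\<in>I. \<exists>j\<in>I. t i \<noteq> t j"
  proof (rule ccontr)
    assume *: "\<not> ?thesis"
    obtain i where i: "i \<in> I" using sum_t by fastforce
    have "(\<Sum>j\<in>I. t j) = (\<Sum>j\<in>I. t i)" by (intro sum.cong refl) (use * i in blast)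
    hence ti: "card I * t i = 1" using sum_t by simp
    hence "card I \<noteq> 0" by (cases "card I") auto
    moreover from this ti have "t i = 1 / card I" by (simp add: field_simps)
    ultimately have "0 < t i" "t i \<le> 1" by simp_all
    hence "t i * t i \<le> t i" by (simp add: mult_left_le)
    with q[OF i] c show False by simp
  qed
  then obtain i j where ij: "i \<in> I" "j \<in> I" "t i \<noteq> t j" by blast
  \<comment> \<open>Difference of the two quadratic equations, factored.\<close>
  have "(t i - t j) * (t i + t j - 1) = 0"
    using q[OF ij(1)] q[OF ij(2)] by (simp add: algebra_simps)
  hence "t i + t j = 1" using ij(3) by simp
  hence "a i + a j = D"
    using ij(1,2) by (simp add: t flip: distrib_left of_real_add)
  thus ?thesis using ij by (intro bexI[of _ i] bexI[of _ j]) auto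
qed

lemma SEDF_prime_dvd:
  assumes S: "SEDF G n m k l A" and p: "prime p" "p dvd n" "\<not> p dvd m * k"
  shows "[m = 2] (mod p)"
proof -
  interpret comm_group G using S by (simp add: SEDF_def)
  have fin: "finite (carrier G)" and A: "\<And>i. i \<in> {1..m} \<Longrightarrow> A i \<subseteq> carrier G \<and> card (A i) = k"
    and dis: "disjoint_family_on A {1..m}" and n: "order G = n" and l: "l > 0"
    using S by (auto simp: SEDF_def)
  obtain \<chi> :: "'a \<Rightarrow> complex" and u
    where mult: "\<And>g h. g \<in> carrier G \<Longrightarrow> h \<in> carrier G \<Longrightarrow> \<chi> (g \<otimes>\<^bsub>G\<^esub> h) = \<chi> g * \<chi> h"
      and root: "\<And>g. g \<in> carrier G \<Longrightarrow> \<chi> g ^ p = 1"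
      and u: "u \<in> carrier G" "\<chi> u \<noteq> 1"
    using prime_character_exists[OF fin p(1)] p(2) n by blast
  have p0: "p > 0" using p(1) prime_gt_0_nat by blast
  have norm: "cmod (\<chi> g) = 1" if "g \<in> carrier G" for g
    using root[OF that] p0 by (metis norm_ge_zero norm_one norm_power power_eq_1_iff neq0_conv)
  have \<chi>1: "\<chi> \<one>\<^bsub>G\<^esub> = 1"
    using mult[of "\<one>\<^bsub>G\<^esub>" "\<one>\<^bsub>G\<^esub>"] norm[of "\<one>\<^bsub>G\<^esub>"] by auto
  have \<chi>_inv: "\<chi> (inv\<^bsub>G\<^esub> g) = cnj (\<chi> g)" if g: "g \<in> carrier G" for g
  proof -
    have "\<chi> g * \<chi> (inv\<^bsub>G\<^esub> g) = 1" using mult[of g "inv\<^bsub>G\<^esub> g"] g \<chi>1 by simp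
    moreover have "\<chi> g * cnj (\<chi> g) = 1" using norm[OF g] by (simp flip: complex_norm_square)
    ultimately show ?thesis by (metis mult_left_cancel mult_zero_left zero_neq_one)
  qed
  \<comment> \<open>Translation by \<open>u\<close> permutes the group and multiplies the full
    character sum by \<open>\<chi> u \<noteq> 1\<close>, so that sum vanishes.\<close>
  have "(\<Sum>g\<in>carrier G. \<chi> g) = (\<Sum>g\<in>carrier G. \<chi> (u \<otimes>\<^bsub>G\<^esub> g))"
    using u(1) by (intro sum.reindex_bij_betw[symmetric])
      (auto simp: bij_betw_def inj_on_cmult surj_const_mult)
  also have "\<dots> = \<chi> u * (\<Sum>g\<in>carrier G. \<chi> g)"
    using u(1) by (simp add: mult sum_distrib_left)
  finally have "(\<Sum>g\<in>carrier G. \<chi> g) = 0" using u(2) by simp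
  hence sum_\<chi>: "(\<Sum>g\<in>carrier G - {\<one>\<^bsub>G\<^esub>}. \<chi> g) = - 1"
    using fin \<chi>1 by (simp add: sum_diff1)
  define a where "a i = (\<Sum>x\<in>A i. \<chi> x)" for i
  \<comment> \<open>Applied twice: to all of \<open>{1..m}\<close>, to get
    \<open>D \<noteq> 0\<close>, and to the \<open>m - 2\<close> indices left after removing a pair
    with sum \<open>D\<close>.\<close>
  have dvd: "p dvd card I * k" if I: "I \<subseteq> {1..m}" and sum0: "(\<Sum>i\<in>I. a i) = 0" for I
  proof -
    have finI: "finite I" using I finite_subset by blast
    have AI: "A i \<subseteq> carrier G" "finite (A i)" "card (A i) = k" if "i \<in> I" for i
      using A[of i] I that fin finite_subset by blast+
    have disI: "\<forall>i\<in>I. \<forall>j\<in>I. i \<noteq> j \<longrightarrow> A i \<inter> A j = {}"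
      using dis I by (auto simp: disjoint_family_on_def)
    have "(\<Sum>x\<in>(\<Union>i\<in>I. A i). of_int 1 * \<chi> x) = 0"
      using sum0 AI(2) finI disI by (subst sum.UNION_disjoint) (auto simp: a_def)
    moreover have "\<chi> x ^ p = 1" if "x \<in> (\<Union>i\<in>I. A i)" for x
      using that AI(1) root by blast
    ultimately have "int p dvd (\<Sum>x\<in>(\<Union>i\<in>I. A i). 1)"
      by (intro prime_dvd_sum_if_sum_of_roots_of_unity_eq_0[OF p(1)]) auto
    also have "(\<Sum>x\<in>(\<Union>i\<in>I. A i). 1) = int (card I * k)"
      using AI finI disI by (subst sum.UNION_disjoint) auto
    finally show ?thesis unfolding int_dvd_int_iff .
  qed
  define D where "D = (\<Sum>i\<in>{1..m}. a i)"
  have "D \<noteq> 0" using dvd[of "{1..m}"] p(3) by (auto simp: D_def)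
  moreover have "(D - a j) * cnj (a j) = - of_real (real l)" if j: "j \<in> {1..m}" for j
  proof -
    have "- of_nat l = (\<Sum>i\<in>{1..m} - {j}. \<Sum>x\<in>A i. \<Sum>y\<in>A j. \<chi> (x \<otimes>\<^bsub>G\<^esub> inv\<^bsub>G\<^esub> y))"
      using SEDF_sum[OF S j, of \<chi>] sum_\<chi> by simp
    also have "\<dots> = (\<Sum>i\<in>{1..m} - {j}. \<Sum>x\<in>A i. \<Sum>y\<in>A j. \<chi> x * cnj (\<chi> y))"
    proof (intro sum.cong refl)
      fix i x y assume "i \<in> {1..m} - {j}" "x \<in> A i" "y \<in> A j"
      hence "x \<in> carrier G" "y \<in> carrier G" using A j by blast+
      thus "\<chi> (x \<otimes>\<^bsub>G\<^esub> inv\<^bsub>G\<^esub> y) = \<chi> x * cnj (\<chi> y)" by (simp add: mult \<chi>_inv)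
    qed
    also have "\<dots> = (\<Sum>i\<in>{1..m} - {j}. a i) * cnj (a j)"
      by (subst sum_distrib_right) (simp add: a_def sum_product)
    also have "(\<Sum>i\<in>{1..m} - {j}. a i) = D - a j"
      using j by (simp add: D_def sum_diff1)
    finally show ?thesis by simp
  qed
  ultimately obtain i j where ij: "i \<in> {1..m}" "j \<in> {1..m}" "i \<noteq> j" "a i + a j = D"
    using pair_sum_eq_total_if_quadratic[of a "{1..m}" D "real l"] l by (auto simp: D_def)
  let ?I = "{1..m} - {i, j}"
  have "D = (\<Sum>i\<in>?I. a i) + (\<Sum>i\<in>{i, j}. a i)"
    unfolding D_def using ij by (intro sum.subset_diff) auto
  hence "(\<Sum>i\<in>?I. a i) = 0" using ij by simp
  hence "p dvd card ?I * k" by (intro dvd) auto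
  moreover have "card ?I = m - 2" using ij by (simp add: card_Diff_subset)
  \<comment> \<open>\<open>p\<close> is prime and does not divide \<open>m * k\<close>, so it does
    not divide \<open>k\<close>. The natural subtraction is exact because two distinct indices give
    \<open>m \<ge> 2\<close>.\<close>
  ultimately have "p dvd m - 2" using p by (auto simp: prime_dvd_mult_iff)
  moreover have "m \<ge> 2" using ij by auto
  ultimately show ?thesis by (simp add: cong_altdef_nat)
qed

theorem theorem3p5:
  fixes G :: "('a, 'b) monoid_scheme" and n m k l :: nat
  assumes "comm_group G" and "finite (carrier G)" and "order G = n"
    and "\<exists>A. SEDF G n m k l A"
    and "k > 1" and "m > 4"
  shows "\<not> [n = 0] (mod k) \<and>
    (\<forall>p. prime p \<and> p dvd n \<and> gcd (m * k) p = 1 \<longrightarrow> [m = 2] (mod p))"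
proof -
  obtain A where S: "SEDF G n m k l A" using assms(4) by blast
  have "\<not> k dvd n"
    using SEDF_not_dvd[OF S] assms(5,6) by simp
  moreover have "[m = 2] (mod p)" if "prime p" "p dvd n" "gcd (m * k) p = 1" for p
  proof -
    have "\<not> p dvd m * k"
      using that(1,3) by (metis gcd_nat.absorb2 not_prime_1)
    thus ?thesis using SEDF_prime_dvd[OF S that(1,2)] by blast
  qed
  ultimately show ?thesis by (auto simp: cong_0_iff)
qed

end
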